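(* Let $p>2$ be a prime, let $G$ be a $p$-group whose commutator subgroup has order $p$, and let $F$ be a field of characteristic $p$. Then for every integer $n\ge 0$, $$\gamma_n(FG^-)=\varphi(\gamma_n(FG)),$$ where $\varphi:FG\to FG$ is the map $\varphi(x)=x-x^*$.
   Context: $FG$ is the group algebra, with the classical involution $*$: the $F$-linear extension of $g\mapsto g^{-1}$, $g\in G$. $FG^-=\{x\in FG : x^*=-x\}$ is the set of skew symmetric elements; it is a Lie subalgebra of $FG$ under the Lie commutator $[x,y]=xy-yx$. Lie commutators are left-normed: $[x_0,x_1,\dots,x_n]=[[x_0,x_1,\dots,x_{n-1}],x_n]$. For $L=FG$ or $L=FG^-$, the term $\gamma_n(L)$ of the lower Lie central series is the $F$-linear span of all $[x_0,x_1,\dots,x_n]$ with $x_i\in L$; in particular $\gamma_0(L)=L$ (so the indexing starts at $0$ and $\gamma_n$ involves $n+1$ entries). *)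

theory Defs
  imports
    "HOL-Computational_Algebra.Primes"
    "HOL-Library.Poly_Mapping"
    "HOL-Algebra.Generated_Groups"
    "HOL-Algebra.Multiplicative_Group"
begin

text \<open>
  The group \<open>G\<close> is a type \<open>'g\<close> of class \<^class>\<open>group_add\<close>. That class does not assume
  commutativity; the group law is merely written \<open>+\<close>, the identity \<open>0\<close> and the inverse
  \<open>- g\<close>. The group algebra \<open>FG\<close> is then the type \<open>'g \<Rightarrow>\<^sub>0 'f\<close> of finitely supported
  functions with the convolution product of \<^theory>\<open>HOL-Library.Poly_Mapping\<close>, in which
  \<open>single g a * single h b = single (g + h) (a * b)\<close>.
\<close>

type_synonym ('g, 'f) group_algebra = "'g \<Rightarrow>\<^sub>0 'f"

definition group_of :: "'g::group_add itself \<Rightarrow> 'g monoid" where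
  "group_of _ = \<lparr>carrier = UNIV, mult = (+), one = 0\<rparr>"

lemma group_group_of: "group (group_of TYPE('g::group_add))"
  by (rule groupI) (auto simp: group_of_def add.assoc intro: left_minus)

text \<open>No finiteness is assumed. Since \<^const>\<open>group.ord\<close> is \<open>0\<close> on elements of infinite
  order, these are excluded whenever \<open>p \<noteq> 0\<close>.\<close>

definition p_group :: "nat \<Rightarrow> ('a, 'b) monoid_scheme \<Rightarrow> bool" where
  "p_group p G \<longleftrightarrow> group G \<and> (\<forall>x\<in>carrier G. \<exists>k. group.ord G x = p ^ k)"

definition scale :: "'f::field \<Rightarrow> ('g, 'f) group_algebra \<Rightarrow> ('g, 'f) group_algebra" where
  "scale c x = Poly_Mapping.map ((*) c) x"

lemma lookup_scale: "Poly_Mapping.lookup (scale c x) g = c * Poly_Mapping.lookup x g"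
  by (simp add: scale_def Poly_Mapping.map.rep_eq when_def)

global_interpretation FG: vector_space scale
  by unfold_locales
    (auto intro!: poly_mapping_eqI simp: lookup_scale Poly_Mapping.lookup_add algebra_simps)

definition star :: "('g::group_add, 'f::field) group_algebra \<Rightarrow> ('g, 'f) group_algebra" where
  "star x =
     (\<Sum>g\<in>Poly_Mapping.keys x. scale (Poly_Mapping.lookup x g) (Poly_Mapping.single (- g) 1))"

lemma star_single: "star (Poly_Mapping.single g c) = Poly_Mapping.single (- g) c"
  by (cases "c = 0") (auto simp: star_def scale_def)

definition skew_elements :: "('g::group_add, 'f::field) group_algebra set" where
  "skew_elements = {x. star x = - x}"

definition lie :: "'a::ring \<Rightarrow> 'a \<Rightarrow> 'a" where
  "lie x y = x * y - y * x"

text \<open>The left-normed commutator \<open>[x\<^sub>0, x\<^sub>1, \<dots>, x\<^sub>n]\<close> is \<open>foldl lie x\<^sub>0 [x\<^sub>1, \<dots>, x\<^sub>n]\<close>.\<close>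

definition lower_lie ::
    "nat \<Rightarrow> ('g::group_add, 'f::field) group_algebra set \<Rightarrow> ('g, 'f) group_algebra set" where
  "lower_lie n L =
     FG.span {foldl lie x xs | x xs. x \<in> L \<and> set xs \<subseteq> L \<and> length xs = n}"

definition skew_part :: "('g::group_add, 'f::field) group_algebra \<Rightarrow> ('g, 'f) group_algebra" where
  "skew_part x = x - star x"

end

theory Submission
  imports Defs "HOL-Number_Theory.Residues"
begin

text \<open>
  Write \<open>\<phi>\<close> for \<^const>\<open>skew_part\<close> and \<open>C\<close> for the commutator subgroup. A \<open>p\<close>-group acts
  trivially by conjugation on a normal subgroup of order \<open>p\<close>, so \<open>C\<close> is central, and each
  \<open>z \<noteq> 1\<close> in \<open>C\<close> generates it.

  One inclusion is formal: since 2 is invertible, a skew element \<open>x\<close> equals \<open>\<phi>(x/2)\<close>, and the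
  lower central series of \<open>FG\<^sup>-\<close> consists of skew elements and lies in that of \<open>FG\<close>.

  For the other inclusion, group elements satisfy \<open>[g, h] = g h (1 - c)\<close> with \<open>c \<in> C\<close>, and \<open>1 - c\<close>
  is a multiple of \<open>1 - z\<close> by a geometric sum. Hence \<open>\<gamma>\<^sub>n(FG)\<close> with \<open>n \<ge> 1\<close> lies in the span of the
  elements \<open>g (1 - z)\<^sup>n\<close> with \<open>g\<close> non-central (\<open>lower_lie_subset_span_generators\<close>), and it suffices
  to show \<open>\<phi>(g (1 - z)\<^sup>n) \<in> \<gamma>\<^sub>n(FG\<^sup>-)\<close> (\<open>skew_part_generators\<close>). This goes by induction on \<open>n\<close>.
  For an \<open>h\<close> that does not commute with \<open>g\<close>, the element \<open>g (1 - z)\<^sup>n\<^sup>+\<^sup>1\<close> is a sum of commutators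
  \<open>[y, h]\<close> in which \<open>y\<close> and all \<open>h\<^sup>-\<^sup>k y h\<^sup>-\<^sup>k\<close> are again of the form covered by the induction
  hypothesis. The heart of the proof is the identity
  \<open>[\<phi>(y), \<phi>(h)] = \<phi>([y, h]) - \<phi>([y, h\<^sup>-\<^sup>1]) = \<phi>([y, h]) + \<phi>([h\<^sup>-\<^sup>1 y h\<^sup>-\<^sup>1, h])\<close>:
  modulo \<open>\<gamma>\<^sub>n\<^sub>+\<^sub>1(FG\<^sup>-)\<close>, replacing \<open>y\<close> by \<open>h\<^sup>-\<^sup>1 y h\<^sup>-\<^sup>1\<close> changes the sign of \<open>\<phi>([y, h])\<close>. The order of
  \<open>h\<close> is odd, and after that many replacements \<open>y\<close> is back while the sign has flipped, so
  \<open>2 \<phi>([y, h])\<close>, and with it \<open>\<phi>([y, h])\<close>, lies in \<open>\<gamma>\<^sub>n\<^sub>+\<^sub>1(FG\<^sup>-)\<close>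
  (\<open>skew_part_lie_monomial\<close>).
\<close>

section \<open>Normal subgroups of prime order in p-groups\<close>

lemma (in group) ord_in_prime_order_subgroup:
  assumes C: "subgroup C G" "card C = p" and "prime p" and d: "d \<in> C" "d \<noteq> \<one>"
  shows "ord d = p"
proof -
  interpret C: group "G\<lparr>carrier := C\<rparr>"
    using subgroup.subgroup_is_group[OF C(1) is_group] .
  have dG: "d \<in> carrier G"
    using subgroup.mem_carrier[OF C(1) d(1)] .
  have "d [^] p = \<one>"
    using C.pow_order_eq_1[of d] d(1) C(2) nat_pow_consistent[of d p C] by (simp add: order_def)
  then have "ord d dvd p"
    using pow_eq_id[OF dG] by simp
  moreover have "ord d \<noteq> 1"
    using ord_eq_1[OF dG] d(2) by simp
  ultimately show ?thesis
    using \<open>prime p\<close> prime_nat_iff by metis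
qed

lemma (in group) generator_of_prime_order_subgroup:
  assumes C: "subgroup C G" "card C = p" and "prime p" and d: "d \<in> C" "d \<noteq> \<one>" and c: "c \<in> C"
  obtains i :: nat where "c = d [^] i"
proof -
  have ord: "ord d = p"
    using ord_in_prime_order_subgroup[OF C \<open>prime p\<close> d] .
  have dG: "d \<in> carrier G"
    using subgroup.mem_carrier[OF C(1) d(1)] .
  have "finite C"
    using C(2) \<open>prime p\<close> by (intro card_ge_0_finite) (simp add: prime_gt_0_nat)
  have "generate G {d} \<subseteq> C"
    using generate_subgroup_incl[of "{d}" C] C(1) d(1) by simp
  then have "generate G {d} = C"
    using card_subset_eq[OF \<open>finite C\<close>] generate_pow_card[OF dG] ord C(2) by simp
  moreover have "generate G {d} = {d [^] k |k. k \<in> (UNIV :: nat set)}"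
    using generate_pow_nat[OF dG] ord \<open>prime p\<close> by (simp add: prime_gt_0_nat)
  ultimately show thesis
    using that c by auto
qed

lemma (in group) nat_pow_commute_up_to_power:
  assumes "g \<in> carrier G" "c \<in> carrier G" "g \<otimes> c = c [^] a \<otimes> g"
  shows "g [^] (k::nat) \<otimes> c [^] (i::nat) = c [^] (i * a ^ k) \<otimes> g [^] k"
proof (induction k arbitrary: i)
  case (Suc k)
  have swap: "g \<otimes> c [^] j = c [^] (j * a) \<otimes> g" for j :: nat
  proof (induction j)
    case (Suc j)
    have "g \<otimes> c [^] Suc j = (g \<otimes> c [^] j) \<otimes> c"
      using assms by (simp add: m_assoc)
    also have "\<dots> = c [^] (j * a) \<otimes> (g \<otimes> c)"
      using assms(1,2) Suc by (simp add: m_assoc)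
    also have "\<dots> = (c [^] (j * a) \<otimes> c [^] a) \<otimes> g"
      using assms by (simp add: m_assoc)
    also have "\<dots> = c [^] (Suc j * a) \<otimes> g"
      using assms by (simp add: nat_pow_mult add.commute)
    finally show ?case .
  qed (use assms in simp)
  have "g [^] Suc k \<otimes> c [^] i = g [^] k \<otimes> c [^] (i * a) \<otimes> g"
    using assms(1,2) swap by (simp add: m_assoc)
  also have "\<dots> = c [^] (i * a * a ^ k) \<otimes> g [^] Suc k"
    using assms(1,2) Suc by (simp add: m_assoc)
  finally show ?case
    by (simp add: mult.assoc)
qed (use assms in simp)

text \<open>By Fermat's little theorem, raising to the \<open>p\<close>-th power is the identity modulo \<open>p\<close>.\<close>

lemma cong_1_if_power_of_prime_power_cong_1:
  fixes a p s :: nat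
  assumes "prime p" "[a ^ (p ^ s) = 1] (mod p)"
  shows "[a = 1] (mod p)"
proof -
  have fermat: "[x ^ p = x] (mod p)" for x
  proof (cases "p dvd x")
    case True
    then have "p dvd x ^ p"
      using assms(1) dvd_trans[OF True dvd_power] prime_gt_0_nat by blast
    then show ?thesis
      using True by (simp add: cong_def mod_eq_0_iff_dvd)
  next
    case False
    then have "[x * x ^ (p - 1) = x * 1] (mod p)"
      using fermat_theorem[OF assms(1)] cong_scalar_left by blast
    then show ?thesis
      using assms(1) by (simp add: power_eq_if prime_gt_0_nat)
  qed
  have "[a ^ (p ^ s) = a] (mod p)"
  proof (induction s)
    case (Suc s)
    have "a ^ (p ^ Suc s) = (a ^ (p ^ s)) ^ p"
      by (simp add: power_mult mult.commute flip: power_mult)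
    then show ?case
      using fermat[of "a ^ (p ^ s)"] Suc cong_trans by metis
  qed simp
  then show ?thesis
    using assms(2) cong_sym cong_trans by blast
qed

lemma (in group) pow_eq_iff_cong_ord:
  assumes "x \<in> carrier G"
  shows "x [^] (m::nat) = x [^] (n::nat) \<longleftrightarrow> [m = n] (mod ord x)"
proof -
  have "x [^] m = x [^] n \<longleftrightarrow> x [^] int m = x [^] int n"
    by (simp add: int_pow_int)
  also have "\<dots> \<longleftrightarrow> [int n = int m] (mod int (ord x))"
    using int_pow_eq[OF assms] by (simp add: cong_iff_dvd_diff)
  also have "\<dots> \<longleftrightarrow> [m = n] (mod ord x)"
    by (simp add: cong_int_iff cong_sym_eq)
  finally show ?thesis .
qed

text \<open>
  Conjugation by \<open>g\<close> raises \<open>c\<close> to some power \<open>a\<close>. Iterating it as often as the order of \<open>g\<close>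
  says, a power \<open>p\<^sup>s\<close>, gives the identity, so \<open>a\<close> to the power \<open>p\<^sup>s\<close> is 1 modulo \<open>p\<close>, and then so
  is \<open>a\<close>.
\<close>

lemma (in group) normal_prime_order_subgroup_central:
  assumes C: "C \<lhd> G" "card C = p" and "prime p" and "p_group p G"
    and c: "c \<in> C" and g: "g \<in> carrier G"
  shows "g \<otimes> c = c \<otimes> g"
proof (cases "c = \<one>")
  case False
  have sub: "subgroup C G"
    using normal_imp_subgroup[OF C(1)] .
  have cG: "c \<in> carrier G"
    using subgroup.mem_carrier[OF sub c] .
  have "g \<otimes> c \<otimes> inv g \<in> C"
    using normal.inv_op_closed2[OF C(1) g c] .
  then obtain a :: nat where "g \<otimes> c \<otimes> inv g = c [^] a"
    by (rule generator_of_prime_order_subgroup[OF sub C(2) \<open>prime p\<close> c False])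
  then have a: "g \<otimes> c = c [^] a \<otimes> g"
    using cG g by (metis inv_solve_right' m_closed nat_pow_closed)
  obtain s where s: "ord g = p ^ s"
    using \<open>p_group p G\<close> g unfolding p_group_def by blast
  have ord: "ord c = p"
    using ord_in_prime_order_subgroup[OF sub C(2) \<open>prime p\<close> c False] .
  have "c [^] (a ^ (p ^ s)) = c [^] (1::nat)"
    using nat_pow_commute_up_to_power[OF g cG a, of "p ^ s" 1] pow_ord_eq_1[OF g] s cG by simp
  then have "[a ^ (p ^ s) = 1] (mod p)"
    unfolding pow_eq_iff_cong_ord[OF cG] ord .
  then have "[a = 1] (mod p)"
    using cong_1_if_power_of_prime_power_cong_1 \<open>prime p\<close> by blast
  then have "c [^] a = c [^] (1::nat)"
    unfolding pow_eq_iff_cong_ord[OF cG] ord .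
  then show ?thesis
    using a cG by simp
qed (use g in simp)


section \<open>The additively written group\<close>

lemma group_of_simps [simp]:
  "carrier (group_of TYPE('g::group_add)) = UNIV"
  "x \<otimes>\<^bsub>group_of TYPE('g)\<^esub> y = x + y"
  "\<one>\<^bsub>group_of TYPE('g)\<^esub> = 0"
  by (simp_all add: group_of_def)

lemma inv_group_of [simp]: "inv\<^bsub>group_of TYPE('g::group_add)\<^esub> x = - x"
  using group.inv_equality[OF group_group_of, of "- x" x] by simp

abbreviation multiple :: "'g::group_add \<Rightarrow> nat \<Rightarrow> 'g" where
  "multiple x i \<equiv> x [^]\<^bsub>group_of TYPE('g)\<^esub> i"

lemma multiple_simps [simp]:
  "multiple x 0 = 0" "multiple x (Suc i) = multiple x i + x"
  by (simp_all add: nat_pow_def)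

lemma add_group_commutator: "g + h + (- h - g + h + g) = h + g" for g h :: "'g::group_add"
  by (metis add.assoc add_minus_cancel diff_conv_add_uminus)

lemma commute_add:
  fixes x y h :: "'g::group_add"
  assumes "x + h = h + x" "y + h = h + y"
  shows "(x + y) + h = h + (x + y)"
  using assms by (metis add.assoc)

lemma commute_minus:
  fixes x h :: "'g::group_add"
  assumes "x + h = h + x"
  shows "- x + h = h + - x"
  using assms by (metis add.assoc add.left_neutral add.right_neutral left_minus right_minus)

lemma commute_multiple:
  fixes x h :: "'g::group_add"
  assumes "x + h = h + x"
  shows "multiple x i + h = h + multiple x i"
proof (induction i)
  case (Suc i)
  then show ?case
    using commute_add[OF Suc assms] by simp
qed simp

section \<open>The group algebra and its involution\<close>

abbreviation monomial :: "'g::group_add \<Rightarrow> ('g, 'f::field) group_algebra" where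
  "monomial g \<equiv> Poly_Mapping.single g 1"

lemma monomial_mult_monomial:
  "monomial g * monomial h = (monomial (g + h) :: ('g::group_add, 'f::field) group_algebra)"
  by (simp add: mult_single)

lemma monomial_power:
  "monomial d ^ i = (monomial (multiple d i) :: ('g::group_add, 'f::field) group_algebra)"
proof (induction i)
  case (Suc i)
  have "monomial d ^ Suc i = monomial d ^ i * (monomial d :: ('g, 'f) group_algebra)"
    by (simp add: power_commutes)
  then show ?case
    by (simp add: Suc monomial_mult_monomial)
qed simp

lemma group_algebra_induct [case_names zero add]:
  fixes x :: "('g, 'f::field) group_algebra"
  assumes "P 0" and "\<And>g c x. P x \<Longrightarrow> P (Poly_Mapping.single g c + x)"
  shows "P x"
proof (induction x rule: update_induct)
  case (update x g c)
  have "Poly_Mapping.update g c x = Poly_Mapping.single g c + x"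
    using update(1)
    by (intro poly_mapping_eqI) (auto simp: lookup_update lookup_add lookup_single not_in_keys_iff_lookup_eq_zero)
  then show ?case
    using assms(2) update by simp
qed (rule assms)

lemma scale_single: "scale c (Poly_Mapping.single g d) = Poly_Mapping.single g (c * d)"
  by (simp add: scale_def)

lemma scale_mult_left: "scale c x * y = scale c (x * y)"
  for x :: "('g::group_add, 'f::field) group_algebra"
  by (simp add: scale_def mult_map_scale_conv_mult mult.assoc)

lemma scale_mult_right: "x * scale c y = scale c (x * y)"
  for x :: "('g::group_add, 'f::field) group_algebra"
proof (induction x rule: group_algebra_induct)
  case (add g d x)
  have "Poly_Mapping.single g d * scale c y = scale c (Poly_Mapping.single g d * y)"
    by (induction y rule: group_algebra_induct)
      (simp_all add: FG.scale_right_distrib distrib_left scale_single mult_single mult.left_commute)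
  then show ?case
    using add by (simp add: FG.scale_right_distrib distrib_right)
qed simp

lemma span_monomials: "FG.span (range monomial) = (UNIV :: ('g::group_add, 'f::field) group_algebra set)"
proof -
  have "x \<in> FG.span (range monomial)" for x :: "('g, 'f) group_algebra"
  proof (induction x rule: group_algebra_induct)
    case (add g c x)
    have "Poly_Mapping.single g c = scale c (monomial g)"
      by (simp add: scale_single)
    then show ?case
      using add by (metis FG.span_add FG.span_base FG.span_scale rangeI)
  qed (rule FG.span_zero)
  then show ?thesis
    by blast
qed

lemma central_monomial_commute:
  fixes x :: "('g::group_add, 'f::field) group_algebra"
  assumes "\<And>g. c + g = g + c"
  shows "monomial c * x = x * monomial c"
  by (induction x rule: group_algebra_induct) (simp_all add: distrib_left distrib_right mult_single assms)

lemma lookup_star: "Poly_Mapping.lookup (star x) g = Poly_Mapping.lookup x (- g)"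
proof -
  have "Poly_Mapping.lookup (star x) g =
      (\<Sum>h\<in>Poly_Mapping.keys x. if h = - g then Poly_Mapping.lookup x h else 0)"
    unfolding star_def lookup_sum
    by (intro sum.cong refl) (auto simp: lookup_scale lookup_single when_def)
  also have "\<dots> = Poly_Mapping.lookup x (- g)"
    by (simp add: in_keys_iff)
  finally show ?thesis .
qed

lemma star_add: "star (x + y) = star x + star y"
  by (intro poly_mapping_eqI) (simp add: lookup_star lookup_add)

lemma star_diff: "star (x - y) = star x - star y"
  by (intro poly_mapping_eqI) (simp add: lookup_star lookup_minus)

lemma star_zero [simp]: "star 0 = 0"
  by (intro poly_mapping_eqI) (simp add: lookup_star)

lemma star_scale: "star (scale c x) = scale c (star x)"
  by (intro poly_mapping_eqI) (simp add: lookup_star lookup_scale)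

lemma star_star: "star (star x) = x"
  by (intro poly_mapping_eqI) (simp add: lookup_star)

lemma star_mult: "star (x * y) = star y * star x"
proof (induction x rule: group_algebra_induct)
  case (add g c x)
  have "star (Poly_Mapping.single g c * y) = star y * star (Poly_Mapping.single g c)"
    by (induction y rule: group_algebra_induct)
      (simp_all add: distrib_left distrib_right star_add star_single mult_single minus_add mult.commute)
  then show ?case
    using add by (simp add: distrib_left distrib_right star_add)
qed simp

section \<open>Skew elements and lower central series\<close>

lemma subspace_skew_elements: "FG.subspace skew_elements"
  by (rule FG.subspaceI) (simp_all add: skew_elements_def star_add star_scale)

lemma skew_part_skew: "skew_part x \<in> skew_elements"
  by (simp add: skew_part_def skew_elements_def star_diff star_star)

lemma lie_skew:
  assumes "x \<in> skew_elements" "y \<in> skew_elements"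
  shows "lie x y \<in> skew_elements"
  using assms by (simp add: skew_elements_def lie_def star_diff star_mult)

lemma skew_part_diff: "skew_part (x - y) = skew_part x - skew_part y"
  by (simp add: skew_part_def star_diff)

lemma skew_part_add: "skew_part (x + y) = skew_part x + skew_part y"
  by (simp add: skew_part_def star_add)

lemma skew_part_zero [simp]: "skew_part 0 = 0"
  by (simp add: skew_part_def)

lemma skew_part_scale: "skew_part (scale c x) = scale c (skew_part x)"
  by (simp add: skew_part_def star_scale FG.scale_right_diff_distrib)

lemma skew_part_sum: "skew_part (\<Sum>i\<in>I. f i) = (\<Sum>i\<in>I. skew_part (f i))"
  by (induction I rule: infinite_finite_induct) (simp_all add: skew_part_add)

lemma skew_part_skew_half:
  fixes x :: "('g::group_add, 'f::field) group_algebra"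
  assumes "(2::'f) \<noteq> 0" "x \<in> skew_elements"
  shows "skew_part (scale (1/2) x) = x"
proof -
  have "skew_part x = scale 2 x"
    using assms(2) FG.scale_left_distrib[of 1 1 x] by (simp add: skew_elements_def skew_part_def)
  then show ?thesis
    using assms(1) by (simp add: skew_part_scale)
qed

lemma skew_part_span:
  assumes "x \<in> FG.span A" "\<And>a. a \<in> A \<Longrightarrow> skew_part a \<in> FG.span B"
  shows "skew_part x \<in> FG.span B"
  using assms(1)
proof (induction rule: FG.span_induct)
  case base
  show ?case
    by (rule FG.subspaceI) (simp_all add: FG.span_zero FG.span_add FG.span_scale skew_part_add skew_part_scale)
qed (rule assms(2))

text \<open>
  The involution satisfies \<open>[x, y]\<^sup>* = -[x\<^sup>*, y\<^sup>*]\<close>, so the four commutators on the left pair up.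
\<close>

lemma lie_skew_part:
  "lie (skew_part x) (skew_part y) = skew_part (lie x y) - skew_part (lie x (star y))"
  by (simp add: lie_def skew_part_def star_diff star_mult star_star algebra_simps)

lemma lie_span:
  fixes x y :: "('g::group_add, 'f::field) group_algebra"
  assumes "x \<in> FG.span A" "y \<in> FG.span B" "\<And>a b. a \<in> A \<Longrightarrow> b \<in> B \<Longrightarrow> lie a b \<in> FG.span D"
  shows "lie x y \<in> FG.span D"
proof -
  have left: "FG.subspace {x. lie x y \<in> FG.span D}" for y
  proof (rule FG.subspaceI)
    show "u + v \<in> {x. lie x y \<in> FG.span D}"
      if "u \<in> {x. lie x y \<in> FG.span D}" "v \<in> {x. lie x y \<in> FG.span D}" for u v
    proof -
      have "lie (u + v) y = lie u y + lie v y"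
        by (simp add: lie_def algebra_simps)
      then show ?thesis
        using that by (simp add: FG.span_add)
    qed
    show "scale c u \<in> {x. lie x y \<in> FG.span D}" if "u \<in> {x. lie x y \<in> FG.span D}" for c u
    proof -
      have "lie (scale c u) y = scale c (lie u y)"
        by (simp add: lie_def scale_mult_left scale_mult_right FG.scale_right_diff_distrib)
      then show ?thesis
        using that by (simp add: FG.span_scale)
    qed
  qed (simp add: lie_def FG.span_zero)
  have swap: "lie u v = - lie v u" for u v :: "('g, 'f) group_algebra"
    by (simp add: lie_def)
  have "lie a y \<in> FG.span D" if "a \<in> A" for a
  proof -
    have "lie y a \<in> FG.span D"
      using assms(2)
    proof (induction rule: FG.span_induct)
      case (step b)
      then show ?case
        using assms(3)[OF that step] swap FG.span_neg by metis
    qed (rule left)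
    then show ?thesis
      using swap FG.span_neg by metis
  qed
  then show ?thesis
    using FG.span_induct[OF assms(1) left] by blast
qed

lemma lower_lie_0: "lower_lie 0 L = FG.span L"
  by (simp add: lower_lie_def)

text \<open>A term of the series is spanned by left-normed commutators, so the first argument enters linearly.\<close>

lemma lie_lower_lie:
  fixes L :: "('g::group_add, 'f::field) group_algebra set"
  assumes "x \<in> lower_lie n L" "y \<in> L"
  shows "lie x y \<in> lower_lie (Suc n) L"
  unfolding lower_lie_def
proof (rule lie_span)
  show "x \<in> FG.span {foldl lie x xs |x xs. x \<in> L \<and> set xs \<subseteq> L \<and> length xs = n}"
    using assms(1) unfolding lower_lie_def .
  show "y \<in> FG.span {y}"
    by (simp add: FG.span_base)
next
  fix a b
  assume "a \<in> {foldl lie x xs |x xs. x \<in> L \<and> set xs \<subseteq> L \<and> length xs = n}" "b \<in> {y}"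
  then obtain x xs where "a = foldl lie x xs" "x \<in> L" "set xs \<subseteq> L" "length xs = n" "b = y"
    by blast
  then have "lie a b = foldl lie x (xs @ [y])" "set (xs @ [y]) \<subseteq> L" "length (xs @ [y]) = Suc n"
    using assms(2) by simp_all
  then show "lie a b \<in> FG.span {foldl lie x xs |x xs. x \<in> L \<and> set xs \<subseteq> L \<and> length xs = Suc n}"
    using \<open>x \<in> L\<close> by (intro FG.span_base) blast
qed

lemma lower_lie_mono: "L \<subseteq> M \<Longrightarrow> lower_lie n L \<subseteq> lower_lie n M"
  unfolding lower_lie_def by (rule FG.span_mono) blast

lemma lower_lie_skew:
  "lower_lie n skew_elements \<subseteq> (skew_elements :: ('g::group_add, 'f::field) group_algebra set)"
  unfolding lower_lie_def
proof (rule FG.span_minimal[OF _ subspace_skew_elements], safe)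
  fix x :: "('g, 'f) group_algebra" and xs :: "('g, 'f) group_algebra list"
  assume "x \<in> skew_elements" "set xs \<subseteq> skew_elements"
  then show "foldl lie x xs \<in> skew_elements"
    by (induction xs arbitrary: x) (simp_all add: lie_skew)
qed

section \<open>Commutators with a group element of odd order\<close>

text \<open>
  Let \<open>x\<^sub>k = h\<^sup>-\<^sup>k y h\<^sup>-\<^sup>k\<close> and let \<open>a\<^sub>k\<close> be the skew part of \<open>[x\<^sub>k, h]\<close>. Since
  \<open>[x, h\<^sup>-\<^sup>1] = -h\<^sup>-\<^sup>1 [x, h] h\<^sup>-\<^sup>1\<close>, the sum of \<open>a\<^sub>k\<close> and \<open>a\<^sub>k\<^sub>+\<^sub>1\<close> is the commutator of the skew parts
  of \<open>x\<^sub>k\<close> and \<open>h\<close>. So the \<open>a\<^sub>k\<close> alternate in sign modulo the next term of the series, while they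
  repeat with the odd period \<open>m\<close>.
\<close>

lemma skew_part_lie_monomial:
  fixes y :: "('g::group_add, 'f::field) group_algebra"
  assumes two: "(2::'f) \<noteq> 0" and m: "odd m" "multiple h m = 0"
    and y: "\<And>k. skew_part (monomial (- h) ^ k * y * monomial (- h) ^ k) \<in> lower_lie n skew_elements"
  shows "skew_part (lie y (monomial h)) \<in> lower_lie (Suc n) skew_elements"
proof -
  define H H' :: "('g, 'f) group_algebra" where "H = monomial h" and "H' = monomial (- h)"
  define x where "x k = H' ^ k * y * H' ^ k" for k
  define a where "a k = skew_part (lie (x k) H)" for k
  let ?\<Gamma> = "lower_lie (Suc n) skew_elements :: ('g, 'f) group_algebra set"
  have inverse: "H' * H = 1" "H * H' = 1"
    by (simp_all add: H_def H'_def monomial_mult_monomial)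
  have subspace: "FG.subspace ?\<Gamma>"
    by (simp add: lower_lie_def)
  have step: "a k + a (Suc k) \<in> ?\<Gamma>" for k
  proof -
    have x_Suc: "x (Suc k) = H' * x k * H'"
      by (simp add: x_def mult.assoc power_commutes)
    have "lie (x (Suc k)) H = - lie (x k) H'"
    proof -
      have "x (Suc k) * H = H' * x k * (H' * H)" "H * x (Suc k) = (H * H') * x k * H'"
        unfolding x_Suc by (simp_all only: mult.assoc)
      then show ?thesis
        by (simp add: lie_def inverse)
    qed
    moreover have "star H = H'"
      by (simp add: H_def H'_def star_single)
    ultimately have "a k + a (Suc k) = lie (skew_part (x k)) (skew_part H)"
      unfolding a_def lie_skew_part using skew_part_diff[of 0 "lie (x k) H'"] by simp
    then show ?thesis
      using lie_lower_lie[OF y[of k] skew_part_skew[of H]] by (simp add: x_def H'_def)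
  qed
  have "(even k \<longrightarrow> a 0 - a k \<in> ?\<Gamma>) \<and> (odd k \<longrightarrow> a 0 + a k \<in> ?\<Gamma>)" for k
  proof (induction k)
    case 0
    then show ?case
      using FG.subspace_0[OF subspace] by simp
  next
    case (Suc k)
    have "a 0 + a (Suc k) = (a 0 - a k) + (a k + a (Suc k))"
      and "a 0 - a (Suc k) = (a 0 + a k) - (a k + a (Suc k))"
      by simp_all
    then show ?case
      using Suc step[of k] FG.subspace_add[OF subspace] FG.subspace_diff[OF subspace] by (metis even_Suc)
  qed
  then have "a 0 + a m \<in> ?\<Gamma>"
    using m(1) by blast
  moreover have "a m = a 0"
  proof -
    have "H ^ m = 1"
      by (simp add: H_def monomial_power m(2))
    then have "H' ^ m = 1"
      using left_right_inverse_power[OF inverse(1), of m] by simp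
    then show ?thesis
      by (simp add: a_def x_def)
  qed
  ultimately have "scale (1/2) (a 0 + a 0) \<in> ?\<Gamma>"
    using FG.subspace_scale[OF subspace] by metis
  moreover have "scale (1/2) (a 0 + a 0) = a 0"
    using two FG.scale_left_distrib[of "1/2" "1/2" "a 0"] by (simp add: FG.scale_right_distrib)
  ultimately show ?thesis
    by (simp add: a_def x_def H_def)
qed

section \<open>Central commutators that generate each other\<close>

lemma geometric_sum_mult: "(\<Sum>j<i. x ^ j) * (1 - x) = 1 - x ^ i" for x :: "'a::ring_1"
proof (induction i)
  case (Suc i)
  have "(\<Sum>j<Suc i. x ^ j) * (1 - x) = (\<Sum>j<i. x ^ j) * (1 - x) + x ^ i * (1 - x)"
    by (simp only: sum.lessThan_Suc distrib_right)
  then show ?case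
    by (simp only: Suc) (simp add: right_diff_distrib power_commutes)
qed simp

lemma lie_monomial:
  "lie (monomial g) (monomial h) =
    (monomial (g + h) * (1 - monomial (- h - g + h + g)) :: ('g::group_add, 'f::field) group_algebra)"
proof -
  show ?thesis
    by (simp only: lie_def right_diff_distrib monomial_mult_monomial mult_1_right add_group_commutator)
qed

text \<open>
  What the argument needs about the commutator subgroup: it is central, and each of its
  nontrivial elements generates it.
\<close>

locale central_cyclic_commutators =
  fixes C :: "'g::group_add set"
  assumes commutator: "- h - g + h + g \<in> C"
    and central: "c \<in> C \<Longrightarrow> c + g = g + c"
    and generator: "c \<in> C \<Longrightarrow> d \<in> C \<Longrightarrow> d \<noteq> 0 \<Longrightarrow> \<exists>i. c = multiple d i"
begin

text \<open>
  Left-normed commutators of \<open>n + 1\<close> elements lie in the span of these generators. For \<open>n = 0\<close> a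
  single group element is allowed, central or not; every proper commutator has a non-central
  product of its entries or vanishes, and non-centrality is what the induction on \<open>n\<close> in
  \<open>skew_part_generators\<close> uses.
\<close>

definition filtration_generators :: "'g \<Rightarrow> nat \<Rightarrow> ('g, 'f::field) group_algebra set" where
  "filtration_generators z n =
     {monomial g * (1 - monomial z) ^ n |g. n = 0 \<or> (\<exists>h. g + h \<noteq> h + g)}"

lemma monomial_commute:
  assumes "c \<in> C"
  shows "monomial c * x = x * (monomial c :: ('g, 'f::field) group_algebra)"
  using central_monomial_commute central[OF assms] by blast

lemma one_minus_power_commute:
  assumes "c \<in> C"
  shows "(1 - monomial c) ^ n * x = x * ((1 - monomial c) ^ n :: ('g, 'f::field) group_algebra)"
  using monomial_commute[OF assms, of x]
  by (intro power_commuting_commutes) (simp add: left_diff_distrib right_diff_distrib)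

lemma lie_mult_one_minus_power:
  assumes "c \<in> C"
  shows "lie (x * (1 - monomial c) ^ n) y = lie x y * ((1 - monomial c) ^ n :: ('g, 'f::field) group_algebra)"
proof -
  have "x * (1 - monomial c) ^ n * y = x * y * (1 - monomial c) ^ n"
    using one_minus_power_commute[OF assms, of n y] by (simp add: mult.assoc)
  then show ?thesis
    by (simp add: lie_def left_diff_distrib mult.assoc)
qed

text \<open>
  The geometric sum lets all factors \<open>1 - c\<close> be compared with one fixed factor \<open>1 - d\<close>. It is
  applied in both directions: to bring commutators into the form of the generators, and to write
  a generator as a sum of commutators.
\<close>

lemma one_minus_monomial_eq:
  assumes "c \<in> C" "d \<in> C" "d \<noteq> 0"
  obtains i where "1 - monomial c =
    (\<Sum>j<i. monomial (multiple d j)) * (1 - monomial d :: ('g, 'f::field) group_algebra)"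
proof -
  obtain i where "c = multiple d i"
    using generator[OF assms] by blast
  then show thesis
    using that[of i] geometric_sum_mult[of "monomial d :: ('g, 'f) group_algebra" i]
    by (simp add: monomial_power)
qed

text \<open>
  The commutator of \<open>g (1 - z)\<^sup>n\<close> with \<open>h\<close> is \<open>g h (1 - c) (1 - z)\<^sup>n\<close>, where \<open>c \<in> C\<close> is trivial
  exactly if \<open>g\<close> and \<open>h\<close> commute. If they do not, then \<open>g h\<close> does not commute with \<open>h\<close> either.
\<close>

lemma lie_generators:
  assumes z: "z \<in> C" "z \<noteq> 0" and a: "a \<in> filtration_generators z n"
  shows "lie a (monomial h) \<in> FG.span (filtration_generators z (Suc n) :: ('g, 'f::field) group_algebra set)"
proof -
  obtain g where a: "a = monomial g * (1 - monomial z) ^ n"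
    using a by (auto simp: filtration_generators_def)
  define c where "c = - h - g + h + g"
  have "c \<in> C"
    by (simp add: c_def commutator)
  have eq: "lie a (monomial h) = monomial (g + h) * (1 - monomial c) * (1 - monomial z) ^ n"
    by (simp add: a lie_mult_one_minus_power[OF z(1)] lie_monomial c_def)
  show ?thesis
  proof (cases "g + h = h + g")
    case True
    then have "c = 0"
      by (metis add.assoc add_minus_cancel c_def diff_conv_add_uminus left_minus)
    then show ?thesis
      by (simp add: eq FG.span_zero)
  next
    case False
    obtain i where i: "1 - monomial c =
        (\<Sum>j<i. monomial (multiple z j)) * (1 - monomial z :: ('g, 'f) group_algebra)"
      using one_minus_monomial_eq[OF \<open>c \<in> C\<close> z] .
    have "lie a (monomial h) =
        (\<Sum>j<i. monomial (g + h + multiple z j) * (1 - monomial z) ^ Suc n)"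
      unfolding eq i
      by (simp add: sum_distrib_left sum_distrib_right mult.assoc flip: monomial_mult_monomial)
    moreover have "monomial (g + h + multiple z j) * (1 - monomial z) ^ Suc n
        \<in> (filtration_generators z (Suc n) :: ('g, 'f) group_algebra set)" for j
    proof -
      have "(g + h + multiple z j) + h \<noteq> h + (g + h + multiple z j)"
      proof
        assume "(g + h + multiple z j) + h = h + (g + h + multiple z j)"
        moreover have "multiple z j + h = h + multiple z j"
          using commute_multiple central[OF z(1)] by blast
        ultimately have "g + h + h = h + g + h"
          by (metis add.assoc add_right_cancel)
        then show False
          using False by simp
      qed
      then show ?thesis
        unfolding filtration_generators_def by blast
    qed
    ultimately show ?thesis
      by (simp add: FG.span_base FG.span_sum)
  qed
qed

lemma lower_lie_subset_span_generators:
  assumes z: "z \<in> C" "z \<noteq> 0"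
  shows "lower_lie n UNIV \<subseteq> FG.span (filtration_generators z n :: ('g, 'f::field) group_algebra set)"
proof -
  have "foldl lie x xs \<in> FG.span (filtration_generators z (length xs))"
    for x :: "('g, 'f) group_algebra" and xs :: "('g, 'f) group_algebra list"
  proof (induction xs rule: rev_induct)
    case Nil
    have "filtration_generators z 0 = range (monomial :: 'g \<Rightarrow> ('g, 'f) group_algebra)"
      by (auto simp: filtration_generators_def)
    then show ?case
      using span_monomials[where 'g = 'g and 'f = 'f] by simp
  next
    case (snoc y xs)
    have "y \<in> FG.span (range monomial)"
      using span_monomials[where 'g = 'g and 'f = 'f] by simp
    then show ?case
      using lie_span[OF snoc] lie_generators[OF z] by fastforce
  qed
  then show ?thesis
    unfolding lower_lie_def by (intro FG.span_minimal) auto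
qed

text \<open>
  Choose \<open>h\<close> not commuting with \<open>g\<close>. Then \<open>[g h\<^sup>-\<^sup>1, h] = g (1 - c)\<close> with \<open>c \<noteq> 1\<close> in \<open>C\<close>, so
  \<open>g (1 - z)\<close> is the sum of the commutators \<open>[g h\<^sup>-\<^sup>1 c\<^sup>j, h]\<close> over a range of \<open>j\<close>. Multiplying
  \<open>g h\<^sup>-\<^sup>1 c\<^sup>j\<close> by powers of \<open>h\<close> on both sides gives an element that still does not commute with
  \<open>h\<close>, so the induction hypothesis covers everything that \<open>skew_part_lie_monomial\<close> asks for.
\<close>

lemma skew_part_generators:
  assumes z: "z \<in> C" and two: "(2::'f::field) \<noteq> 0"
    and torsion: "\<And>h::'g. \<exists>m. odd m \<and> multiple h m = 0"
    and "x \<in> (filtration_generators z n :: ('g, 'f) group_algebra set)"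
  shows "skew_part x \<in> lower_lie n skew_elements"
  using assms(4)
proof (induction n arbitrary: x)
  case 0
  then show ?case
    by (simp add: lower_lie_0 FG.span_base skew_part_skew)
next
  case (Suc n)
  let ?D = "1 - monomial z :: ('g, 'f) group_algebra"
  obtain g h where x: "x = monomial g * ?D ^ Suc n" and gh: "g + h \<noteq> h + g"
    using Suc.prems by (auto simp: filtration_generators_def)
  define c where "c = - h - (g - h) + h + (g - h)"
  have "c \<in> C"
    by (simp only: c_def commutator)
  have c_central: "multiple c j + k = k + multiple c j" for j k
    using commute_multiple central[OF \<open>c \<in> C\<close>] by blast
  have "c \<noteq> 0"
  proof
    assume "c = 0"
    then have "g = h + (g - h)"
      using add_group_commutator[of "g - h" h] by (simp add: c_def)
    then have "g + h = h + (g - h) + h"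
      by simp
    then have "g + h = h + g"
      by (simp add: add.assoc)
    then show False
      using gh by simp
  qed
  obtain i where i: "?D = (\<Sum>j<i. monomial (multiple c j)) * (1 - monomial c)"
    using one_minus_monomial_eq[OF z \<open>c \<in> C\<close> \<open>c \<noteq> 0\<close>] .
  define y where "y j = monomial (g - h + multiple c j) * ?D ^ n" for j
  have lie_y: "lie (y j) (monomial h) = monomial g * (monomial (multiple c j) * (1 - monomial c)) * ?D ^ n" for j
  proof -
    have "g - h + (h + multiple c j) = g + multiple c j"
      by (metis add.assoc diff_add_cancel)
    then have "lie (monomial (g - h + multiple c j)) (monomial h) =
        lie (monomial (g - h)) (monomial h) * (monomial (multiple c j) :: ('g, 'f) group_algebra)"
      by (simp add: lie_def left_diff_distrib monomial_mult_monomial add.assoc c_central)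
    also have "\<dots> = monomial g * ((1 - monomial c) * monomial (multiple c j))"
      by (simp add: lie_monomial c_def mult.assoc)
    also have "(1 - monomial c) * monomial (multiple c j) =
        monomial (multiple c j) * (1 - monomial c :: ('g, 'f) group_algebra)"
      using one_minus_power_commute[OF \<open>c \<in> C\<close>, of 1] by simp
    finally show ?thesis
      by (simp add: y_def lie_mult_one_minus_power[OF z] mult.assoc)
  qed
  have "x = monomial g * ?D * ?D ^ n"
    by (simp add: x mult.assoc)
  also have "\<dots> = (\<Sum>j<i. lie (y j) (monomial h))"
    unfolding lie_y by (subst i) (simp add: sum_distrib_left sum_distrib_right)
  finally have "skew_part x = (\<Sum>j<i. skew_part (lie (y j) (monomial h)))"
    by (simp add: skew_part_sum)
  moreover have "skew_part (lie (y j) (monomial h)) \<in> lower_lie (Suc n) skew_elements" for j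
  proof -
    obtain m where m: "odd m" "multiple h m = 0"
      using torsion by blast
    show ?thesis
    proof (rule skew_part_lie_monomial[OF two m])
      fix k
      define w where "w = multiple (- h) k"
      define u where "u = w + (g - h) + multiple c j + w"
      have "monomial (- h) ^ k * y j * monomial (- h) ^ k = monomial u * ?D ^ n"
        unfolding y_def monomial_power w_def[symmetric] u_def
        using one_minus_power_commute[OF z, of n "monomial w :: ('g, 'f) group_algebra"]
        by (simp add: mult.assoc flip: monomial_mult_monomial)
      moreover have "u + h \<noteq> h + u"
      proof
        assume u: "u + h = h + u"
        have w: "w + h = h + w"
          unfolding w_def by (intro commute_multiple commute_minus refl)
        \<comment> \<open>Everything \<open>g\<close> is built from here commutes with \<open>h\<close>.\<close>
        have "g = - w + u + - w + - multiple c j + h"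
          by (simp add: u_def add.assoc diff_conv_add_uminus del: add_uminus_conv_diff)
        moreover have "(- w + u + - w + - multiple c j + h) + h = h + (- w + u + - w + - multiple c j + h)"
          by (intro commute_add commute_minus u w c_central refl)
        ultimately have "g + h = h + g"
          by simp
        then show False
          using gh by simp
      qed
      ultimately have "monomial (- h) ^ k * y j * monomial (- h) ^ k \<in> filtration_generators z n"
        unfolding filtration_generators_def by blast
      then show "skew_part (monomial (- h) ^ k * y j * monomial (- h) ^ k) \<in> lower_lie n skew_elements"
        by (rule Suc.IH)
    qed
  qed
  ultimately show ?case
    by (simp add: lower_lie_def FG.span_sum)
qed

end

section \<open>The lower central series of the skew elements\<close>

theorem corollary1:
  fixes p n :: nat
  assumes "prime p" and "p > 2"
    and "p_group p (group_of TYPE('g::group_add))"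
    and "card (derived (group_of TYPE('g)) (carrier (group_of TYPE('g)))) = p"
    and "CHAR('f::field) = p"
  shows "lower_lie n (skew_elements :: ('g, 'f) group_algebra set)
       = skew_part ` lower_lie n (UNIV :: ('g, 'f) group_algebra set)"
proof -
  let ?G = "group_of TYPE('g)"
  interpret G: group ?G
    by (rule group_group_of)
  define C where "C = derived ?G (carrier ?G)"
  have normal: "C \<lhd> ?G"
    unfolding C_def by (rule G.derived_self_is_normal)
  have card: "card C = p"
    using assms(4) by (simp add: C_def)
  have subgroup: "subgroup C ?G"
    using normal_imp_subgroup[OF normal] .
  interpret central_cyclic_commutators C
  proof
    fix c d g h :: 'g
    have "- h + - g + - (- h) + - (- g) \<in> derived_set ?G (carrier ?G)"
      by (simp only: group_of_simps inv_group_of) blast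
    then have "- h + - g + - (- h) + - (- g) \<in> C"
      unfolding C_def derived_def by (rule generate.incl)
    then show "- h - g + h + g \<in> C"
      by simp
    show "c + g = g + c" if "c \<in> C"
      using G.normal_prime_order_subgroup_central[OF normal card assms(1,3) that, of g] by simp
    show "\<exists>i. c = multiple d i" if "c \<in> C" "d \<in> C" "d \<noteq> 0"
      by (rule G.generator_of_prime_order_subgroup[OF subgroup card assms(1) that(2) _ that(1)])
        (use that(3) in auto)
  qed
  have "\<not> CHAR('f) dvd 2"
    using assms(2,5) by (auto dest: dvd_imp_le)
  then have two: "(2::'f) \<noteq> 0"
    using of_nat_eq_0_iff_char_dvd[where 'a = 'f, of 2] by simp
  have torsion: "\<exists>m. odd m \<and> multiple h m = 0" for h :: 'g
  proof -
    obtain s where "G.ord h = p ^ s"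
      using assms(3) by (auto simp: p_group_def)
    then have "multiple h (p ^ s) = 0"
      using G.pow_ord_eq_1[of h] by simp
    moreover have "odd (p ^ s)"
      using prime_odd_nat[OF assms(1,2)] by simp
    ultimately show ?thesis
      by blast
  qed
  have "C \<noteq> {0}"
    using card assms(2) by auto
  then obtain z where z: "z \<in> C" "z \<noteq> 0"
    using subgroup.one_closed[OF subgroup] by auto
  show ?thesis
  proof
    show "lower_lie n (skew_elements :: ('g, 'f) group_algebra set) \<subseteq> skew_part ` lower_lie n UNIV"
    proof
      fix x :: "('g, 'f) group_algebra"
      assume x: "x \<in> lower_lie n skew_elements"
      then have "scale (1/2) x \<in> lower_lie n UNIV"
        using lower_lie_mono[of skew_elements UNIV n] by (auto simp: lower_lie_def FG.span_scale)
      moreover have "x = skew_part (scale (1/2) x)"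
        using x lower_lie_skew skew_part_skew_half[OF two] by force
      ultimately show "x \<in> skew_part ` lower_lie n UNIV"
        by blast
    qed
    show "skew_part ` lower_lie n UNIV \<subseteq> lower_lie n (skew_elements :: ('g, 'f) group_algebra set)"
    proof safe
      fix x :: "('g, 'f) group_algebra"
      assume "x \<in> lower_lie n UNIV"
      then have "x \<in> FG.span (filtration_generators z n)"
        using lower_lie_subset_span_generators[OF z] by blast
      then show "skew_part x \<in> lower_lie n skew_elements"
        unfolding lower_lie_def
        by (rule skew_part_span) (use skew_part_generators[OF z(1) two torsion] in \<open>simp add: lower_lie_def\<close>)
    qed
  qed
qed

end
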